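(* Let $(x_n)_n$ be a (Schauder) basis of a Banach space $X$. (1) If $(x_n)_n$ is $C$-RUC, then every sequence $(x_n^* )_n$ in $X^*$ biorthogonal to $(x_n)_n$ is $2C$-RUD. (2) If the biorthogonal sequence $(x_n^* )_n$ is $C$-RUC, then $(x_n)_n$ is $C\cdot D$-RUD, where $D$ is the basic constant of $(x_n)_n$.
   Context: For vectors $y_1,\dots,y_n$ put $\mathbb E_\varepsilon\|\sum_{i=1}^n\varepsilon_iy_i\|=2^{-n}\sum_{\varepsilon\in\{-1,1\}^n}\|\sum_{i=1}^n\varepsilon_iy_i\|$. A basic sequence $(y_n)_n$ is $C$-RUC if $\mathbb E_\varepsilon\|\sum_{i=1}^n\varepsilon_ia_iy_i\|\le C\|\sum_{i=1}^na_iy_i\|$ for all $n$ and all scalars $(a_i)_{i=1}^n$. It is $C$-RUD if $\|\sum_{i=1}^na_iy_i\|\le C\,\mathbb E_\varepsilon\|\sum_{i=1}^n\varepsilon_ia_iy_i\|$ for all $n$ and all scalars $(a_i)_{i=1}^n$. The basic constant of a basis $(x_n)_n$ is $\sup_n\|P_n\|$, where $P_n(\sum_i a_ix_i)=\sum_{i=1}^na_ix_i$. *)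

theory Defs
  imports "HOL-Analysis.Analysis"
begin

text \<open>The scalar field of a Banach space is \<open>\<real>\<close> or \<open>\<complex>\<close>. The class below has exactly these
  two fields as members, up to isomorphism; the norm need not be mentioned, since the usual
  absolute value is the only multiplicative norm on \<open>\<complex>\<close> extending that of \<open>\<real>\<close>.\<close>

class real_or_complex_field = real_normed_field +
  assumes real_or_complex:
    "(\<forall>z. \<exists>a. z = a *\<^sub>R 1) \<or> (\<exists>j. j * j = - 1 \<and> (\<forall>z. \<exists>a b. z = a *\<^sub>R 1 + b *\<^sub>R j))"

instance real :: real_or_complex_field
  by standard simp

instance complex :: real_or_complex_field
proof
  have "\<exists>a b. z = a *\<^sub>R 1 + b *\<^sub>R \<i>" for z
    by (intro exI[of _ "Re z"] exI[of _ "Im z"]) (simp add: complex_eq_iff)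
  then show "(\<forall>z::complex. \<exists>a. z = a *\<^sub>R 1) \<or>
      (\<exists>j::complex. j * j = - 1 \<and> (\<forall>z. \<exists>a b. z = a *\<^sub>R 1 + b *\<^sub>R j))"
    by (metis i_squared)
qed

text \<open>The type class \<^class>\<open>banach\<close> supplies the norm, completeness and the real scalar
  multiplication; \<open>smul\<close> extends the latter to the field \<open>'k\<close>. For \<open>'k = \<real>\<close> it is forced to be
  \<^const>\<open>scaleR\<close>.\<close>

locale banach_space_over = vector_space smul
  for smul :: "'k::real_or_complex_field \<Rightarrow> 'a::banach \<Rightarrow> 'a" +
  assumes scale_of_real: "smul (of_real r) v = r *\<^sub>R v"
    and norm_scale: "norm (smul c v) = norm c * norm v"

lemma banach_space_over_scaleR:
  "banach_space_over (scaleR :: real \<Rightarrow> 'a::banach \<Rightarrow> 'a)"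
  by unfold_locales (simp_all add: algebra_simps)

lemma banach_space_over_complex: "banach_space_over ((*) :: complex \<Rightarrow> complex \<Rightarrow> complex)"
  by unfold_locales (simp_all add: algebra_simps scaleR_conv_of_real norm_mult)

definition dual_space :: "('k::real_normed_field \<Rightarrow> 'a::real_normed_vector \<Rightarrow> 'a) \<Rightarrow> ('a \<Rightarrow>\<^sub>L 'k) set"
  where "dual_space smul = {f. \<forall>c v. blinfun_apply f (smul c v) = c * blinfun_apply f v}"

text \<open>Scalar multiplication of functionals, \<open>v \<mapsto> c * f v\<close>.\<close>

definition dual_scale :: "'k::real_normed_field \<Rightarrow> ('a::real_normed_vector \<Rightarrow>\<^sub>L 'k) \<Rightarrow> ('a \<Rightarrow>\<^sub>L 'k)"
  where "dual_scale c f = blinfun_mult_right c o\<^sub>L f"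

lemma dual_scale_apply: "blinfun_apply (dual_scale c f) v = c * blinfun_apply f v"
  by (simp add: dual_scale_def blinfun_mult_right.rep_eq)

text \<open>All sequences are indexed from \<open>0\<close>, so that \<open>y 0, \<dots>, y (n - 1)\<close> are the first \<open>n\<close> terms.\<close>

definition schauder_basis_of ::
  "('k::real_normed_field \<Rightarrow> 'b::real_normed_vector \<Rightarrow> 'b) \<Rightarrow> (nat \<Rightarrow> 'b) \<Rightarrow> 'b set \<Rightarrow> bool"
  where "schauder_basis_of smul y V \<longleftrightarrow>
    range y \<subseteq> V \<and> (\<forall>v\<in>V. \<exists>!a. (\<lambda>i. smul (a i) (y i)) sums v)"

definition basic_sequence ::
  "('k::real_normed_field \<Rightarrow> 'b::real_normed_vector \<Rightarrow> 'b) \<Rightarrow> (nat \<Rightarrow> 'b) \<Rightarrow> bool"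
  where "basic_sequence smul y \<longleftrightarrow>
    schauder_basis_of smul y (closure (module.span smul (range y)))"

definition sign_mean :: "nat \<Rightarrow> (nat \<Rightarrow> 'b::real_normed_vector) \<Rightarrow> real"
  where "sign_mean n y =
    (\<Sum>\<epsilon>\<in>{..<n} \<rightarrow>\<^sub>E {- 1, 1::real}. norm (\<Sum>i<n. \<epsilon> i *\<^sub>R y i)) / 2 ^ n"

definition RUC ::
  "('k::real_normed_field \<Rightarrow> 'b::real_normed_vector \<Rightarrow> 'b) \<Rightarrow> real \<Rightarrow> (nat \<Rightarrow> 'b) \<Rightarrow> bool"
  where "RUC smul C y \<longleftrightarrow> basic_sequence smul y \<and>
    (\<forall>n a. sign_mean n (\<lambda>i. smul (a i) (y i)) \<le> C * norm (\<Sum>i<n. smul (a i) (y i)))"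

definition RUD ::
  "('k::real_normed_field \<Rightarrow> 'b::real_normed_vector \<Rightarrow> 'b) \<Rightarrow> real \<Rightarrow> (nat \<Rightarrow> 'b) \<Rightarrow> bool"
  where "RUD smul C y \<longleftrightarrow> basic_sequence smul y \<and>
    (\<forall>n a. norm (\<Sum>i<n. smul (a i) (y i)) \<le> C * sign_mean n (\<lambda>i. smul (a i) (y i)))"

definition basis_coeff ::
  "('k::real_normed_field \<Rightarrow> 'b::real_normed_vector \<Rightarrow> 'b) \<Rightarrow> (nat \<Rightarrow> 'b) \<Rightarrow> 'b \<Rightarrow> nat \<Rightarrow> 'k"
  where "basis_coeff smul y v = (THE a. (\<lambda>i. smul (a i) (y i)) sums v)"

definition basis_proj ::
  "('k::real_normed_field \<Rightarrow> 'b::real_normed_vector \<Rightarrow> 'b) \<Rightarrow> (nat \<Rightarrow> 'b) \<Rightarrow> nat \<Rightarrow> 'b \<Rightarrow> 'b"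
  where "basis_proj smul y n v = (\<Sum>i<n. smul (basis_coeff smul y v i) (y i))"

text \<open>For a basis of a Banach space the projections are bounded, uniformly in \<open>n\<close>, so both
  \<^const>\<open>onorm\<close> and the supremum are the genuine ones.\<close>

definition basic_constant ::
  "('k::real_normed_field \<Rightarrow> 'b::real_normed_vector \<Rightarrow> 'b) \<Rightarrow> (nat \<Rightarrow> 'b) \<Rightarrow> real"
  where "basic_constant smul y = (SUP n\<in>{1..}. onorm (basis_proj smul y n))"

definition biorthogonal ::
  "(nat \<Rightarrow> ('a::real_normed_vector \<Rightarrow>\<^sub>L 'k::real_normed_field)) \<Rightarrow> (nat \<Rightarrow> 'a) \<Rightarrow> bool"
  where "biorthogonal f x \<longleftrightarrow> (\<forall>m n. blinfun_apply (f m) (x n) = (if m = n then 1 else 0))"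

end

theory Submission
  imports Defs
begin

text \<open>Both implications rest on one observation about a diagonal pairing. If \<open>\<phi>\<^sub>i (y\<^sub>j) = 0\<close> for
  \<open>i \<noteq> j\<close>, then for \<^emph>\<open>every\<close> choice of signs
  \<open>(\<Sum>\<^sub>i \<epsilon>\<^sub>i \<phi>\<^sub>i) (\<Sum>\<^sub>j \<epsilon>\<^sub>j y\<^sub>j) = \<Sum>\<^sub>i \<phi>\<^sub>i (y\<^sub>i)\<close>, because \<open>\<epsilon>\<^sub>i\<^sup>2 = 1\<close>. So the modulus of the
  right-hand side is at most \<open>\<parallel>\<Sum> \<epsilon>\<^sub>i \<phi>\<^sub>i\<parallel> \<parallel>\<Sum> \<epsilon>\<^sub>j y\<^sub>j\<parallel>\<close> for all signs at once; taking square
  roots, averaging and applying the Cauchy-Schwarz inequality bounds it by the product of the two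
  sign means (\<open>norm_pairing_le_sign_mean_mult\<close>).

  For the first part, apply this to \<open>\<phi>\<^sub>i = a\<^sub>i f\<^sub>i\<close> and to the terms \<open>y\<^sub>i = f\<^sub>i(v) x\<^sub>i\<close> of the expansion
  of \<open>v\<close>. The sign mean of the first \<open>N\<close> of these terms is at most \<open>C \<parallel>P\<^sub>N v\<parallel>\<close>, and
  \<open>P\<^sub>N v \<longlonglongrightarrow> v\<close>, so that \<open>\<Sum> a\<^sub>i f\<^sub>i\<close> is bounded at \<open>v\<close> by \<open>C \<parallel>v\<parallel>\<close> times its sign mean. This gives
  the constant \<open>C\<close>, and \<open>C \<le> 2 C\<close> because \<open>C \<ge> 0\<close>. For the second part, take \<open>y\<^sub>i = a\<^sub>i x\<^sub>i\<close>, let \<open>g\<close> be a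
  functional of norm at most one with \<open>|g v| = \<parallel>v\<parallel>\<close> at \<open>v = \<Sum> y\<^sub>i\<close>, and put \<open>\<phi>\<^sub>i = g(x\<^sub>i) f\<^sub>i\<close>. Then
  \<open>\<Sum>\<^sub>i\<^sub><\<^sub>n \<phi>\<^sub>i = g \<circ> P\<^sub>n\<close> has norm at most the basic constant, which turns the RUC bound for
  \<open>f\<close> into one for the sign mean of \<open>\<phi>\<close>.

  Two classical theorems are needed on the way. The uniform boundedness principle bounds the
  norms of the \<open>P\<^sub>n\<close>, which are continuous because the biorthogonal functionals are; by duality it also
  shows that \<open>f\<close> is a basic sequence, since the set of functionals \<open>g\<close> with \<open>g \<circ> P\<^sub>n \<longlonglongrightarrow> g\<close> is a
  closed subspace containing every \<open>f\<^sub>k\<close>. The Hahn-Banach theorem, over either scalar field, supplies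
  the norming functional \<open>g\<close>.\<close>

section \<open>Sign means\<close>

lemma sign_mean_nonneg: "0 \<le> sign_mean n y"
  unfolding sign_mean_def by (simp add: sum_nonneg)

lemma sign_mean_0 [simp]: "sign_mean 0 y = 0"
  unfolding sign_mean_def by simp

lemma sign_mean_cong:
  assumes "\<And>i. i < n \<Longrightarrow> y i = z i"
  shows "sign_mean n y = sign_mean n z"
  unfolding sign_mean_def using assms by simp

text \<open>The sign of a vanishing term is irrelevant, so each pattern of the other signs is counted twice,
  which the normalisation \<open>2 ^ Suc n\<close> compensates.\<close>

lemma sign_mean_Suc_zero:
  assumes "y n = 0"
  shows "sign_mean (Suc n) y = sign_mean n y"
proof -
  let ?S = "{- 1, 1 :: real}" and ?h = "\<lambda>n \<epsilon>. norm (\<Sum>i<n. \<epsilon> i *\<^sub>R y i)"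
  have inj: "inj_on (\<lambda>(s, \<epsilon>). \<epsilon>(n := s)) (?S \<times> ({..<n} \<rightarrow>\<^sub>E ?S))"
    by (rule inj_combinator) simp
  have "(\<Sum>\<epsilon>\<in>{..<Suc n} \<rightarrow>\<^sub>E ?S. ?h (Suc n) \<epsilon>)
      = (\<Sum>p\<in>?S \<times> ({..<n} \<rightarrow>\<^sub>E ?S). ?h (Suc n) ((\<lambda>(s, \<epsilon>). \<epsilon>(n := s)) p))"
    unfolding lessThan_Suc PiE_insert_eq
    by (simp only: sum.reindex[OF inj] o_def)
  also have "\<dots> = (\<Sum>p\<in>?S \<times> ({..<n} \<rightarrow>\<^sub>E ?S). ?h n (snd p))"
  proof (rule sum.cong[OF refl])
    fix p :: "real \<times> (nat \<Rightarrow> real)"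
    have "(\<Sum>i<n. (case p of (s, \<epsilon>) \<Rightarrow> \<epsilon>(n := s)) i *\<^sub>R y i) = (\<Sum>i<n. snd p i *\<^sub>R y i)"
      by (rule sum.cong) (simp_all add: split_def)
    then show "?h (Suc n) (case p of (s, \<epsilon>) \<Rightarrow> \<epsilon>(n := s)) = ?h n (snd p)"
      by (simp only: sum.lessThan_Suc assms scaleR_zero_right add_0_right)
  qed
  also have "\<dots> = (\<Sum>s\<in>?S. \<Sum>\<epsilon>\<in>{..<n} \<rightarrow>\<^sub>E ?S. ?h n \<epsilon>)"
    by (simp only: sum.cartesian_product split_def)
  also have "\<dots> = 2 * (\<Sum>\<epsilon>\<in>{..<n} \<rightarrow>\<^sub>E ?S. ?h n \<epsilon>)"
    by simp
  finally show ?thesis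
    unfolding sign_mean_def by simp
qed

lemma sign_mean_extend_zero:
  assumes "n \<le> N" and "\<And>i. n \<le> i \<Longrightarrow> i < N \<Longrightarrow> y i = 0"
  shows "sign_mean N y = sign_mean n y"
  using assms
proof (induction N rule: dec_induct)
  case (step N)
  then show ?case
    using sign_mean_Suc_zero[of y N] by simp
qed simp

text \<open>The pairing of the two signed sums is diagonal and each sign occurs squared, so its value does not
  depend on the signs. The bound by a product of norms therefore holds for each sign pattern, and
  Cauchy-Schwarz for the square roots of the norms separates the two averages; averaging the
  product itself would leave the mean of a product.\<close>

lemma norm_pairing_le_sign_mean_mult:
  fixes \<phi> :: "nat \<Rightarrow> 'a::real_normed_vector \<Rightarrow>\<^sub>L 'b::real_normed_vector"
  assumes "\<And>i j. i < n \<Longrightarrow> j < n \<Longrightarrow> i \<noteq> j \<Longrightarrow> blinfun_apply (\<phi> i) (y j) = 0"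
  shows "norm (\<Sum>i<n. blinfun_apply (\<phi> i) (y i)) \<le> sign_mean n \<phi> * sign_mean n y"
proof -
  let ?S = "{..<n} \<rightarrow>\<^sub>E {- 1, 1 :: real}"
  let ?F = "\<lambda>\<epsilon>. norm (\<Sum>i<n. \<epsilon> i *\<^sub>R \<phi> i)" and ?Y = "\<lambda>\<epsilon>. norm (\<Sum>i<n. \<epsilon> i *\<^sub>R y i)"
  define c where "c = norm (\<Sum>i<n. blinfun_apply (\<phi> i) (y i))"
  have pointwise: "c \<le> ?F \<epsilon> * ?Y \<epsilon>" if \<epsilon>: "\<epsilon> \<in> ?S" for \<epsilon>
  proof -
    have sq: "\<epsilon> i * \<epsilon> i = 1" if "i < n" for i
      using PiE_mem[OF \<epsilon>, of i] that by auto
    have "blinfun_apply (\<Sum>i<n. \<epsilon> i *\<^sub>R \<phi> i) (\<Sum>j<n. \<epsilon> j *\<^sub>R y j)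
        = (\<Sum>j<n. \<Sum>i<n. (\<epsilon> i * \<epsilon> j) *\<^sub>R blinfun_apply (\<phi> i) (y j))"
      by (simp add: blinfun.sum_left blinfun.sum_right blinfun.scaleR_left blinfun.scaleR_right
          scaleR_sum_right mult.commute)
    also have "\<dots> = (\<Sum>j<n. \<Sum>i<n. if i = j then blinfun_apply (\<phi> i) (y i) else 0)"
      using assms by (intro sum.cong) (auto simp: sq)
    also have "\<dots> = (\<Sum>i<n. blinfun_apply (\<phi> i) (y i))"
      by simp
    finally show ?thesis
      unfolding c_def using norm_blinfun by metis
  qed
  have card: "card ?S = 2 ^ n"
  proof -
    have "card {- 1, 1 :: real} = 2" by simp
    then show ?thesis
      by (simp only: card_PiE finite_lessThan prod_constant card_lessThan)
  qed
  have "2 ^ n * sqrt c = (\<Sum>\<epsilon>\<in>?S. sqrt c)"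
    using card by simp
  also have "\<dots> \<le> (\<Sum>\<epsilon>\<in>?S. sqrt (?F \<epsilon>) * sqrt (?Y \<epsilon>))"
    using pointwise by (intro sum_mono) (simp flip: real_sqrt_mult)
  finally have "(2 ^ n * sqrt c)\<^sup>2 \<le> (\<Sum>\<epsilon>\<in>?S. sqrt (?F \<epsilon>) * sqrt (?Y \<epsilon>))\<^sup>2"
    by (intro power_mono) (simp_all add: c_def)
  also have "\<dots> \<le> (\<Sum>\<epsilon>\<in>?S. ?F \<epsilon>) * (\<Sum>\<epsilon>\<in>?S. ?Y \<epsilon>)"
    using Cauchy_Schwarz_ineq_sum[of "\<lambda>\<epsilon>. sqrt (?F \<epsilon>)" "\<lambda>\<epsilon>. sqrt (?Y \<epsilon>)" ?S] by simp
  finally have "2 ^ n * 2 ^ n * c \<le> (\<Sum>\<epsilon>\<in>?S. ?F \<epsilon>) * (\<Sum>\<epsilon>\<in>?S. ?Y \<epsilon>)"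
    by (simp add: c_def power_mult_distrib power2_eq_square[of "2 ^ n :: real"])
  then have "c \<le> (\<Sum>\<epsilon>\<in>?S. ?F \<epsilon>) * (\<Sum>\<epsilon>\<in>?S. ?Y \<epsilon>) / (2 ^ n * 2 ^ n)"
    by (subst pos_le_divide_eq) (simp_all only: mult.commute[of c], simp)
  then show ?thesis
    unfolding sign_mean_def c_def times_divide_times_eq .
qed

section \<open>The uniform boundedness principle\<close>

text \<open>By the Baire category theorem one of the closed sets on which all \<open>T i\<close> are bounded by \<open>k\<close>
  contains a ball; differences of points of that ball bound the operators on a ball about the
  origin.\<close>

theorem uniform_boundedness:
  fixes T :: "'i::countable \<Rightarrow> 'a::banach \<Rightarrow>\<^sub>L 'b::real_normed_vector"
  assumes "\<And>v. bdd_above (range (\<lambda>i. norm (blinfun_apply (T i) v)))"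
  shows "\<exists>K. \<forall>i. norm (T i) \<le> K"
proof -
  define A where "A k = {v. \<forall>i. norm (blinfun_apply (T i) v) \<le> real k}" for k :: nat
  have closedA: "closed (A k)" for k
    unfolding A_def
    by (intro closed_Collect_all closed_Collect_le continuous_intros)
  have "(\<Union>k. A k) = UNIV"
  proof -
    have "\<exists>k. v \<in> A k" for v
    proof -
      obtain M where "\<And>i. norm (blinfun_apply (T i) v) \<le> M"
        using assms[of v] by (auto simp: bdd_above_def)
      moreover obtain k where "M \<le> real k"
        using real_arch_simple by blast
      ultimately have "v \<in> A k"
        unfolding A_def by (auto intro: order_trans)
      then show ?thesis ..
    qed
    then show ?thesis by auto
  qed
  have "\<exists>k. interior (A k) \<noteq> {}"
  proof (rule ccontr)
    assume "\<not> ?thesis"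
    then have "euclidean interior_of \<Union>(range A) = {}"
      using closedA completely_metrizable_space_euclidean
      by (intro Baire_category_alt) auto
    then show False
      using \<open>(\<Union>k. A k) = UNIV\<close> by simp
  qed
  then obtain k w r where r: "r > 0" "cball w r \<subseteq> A k"
    by (metis all_not_in_conv mem_interior_cball)
  have "norm (T i) \<le> 2 * real k / r" for i
  proof (rule norm_blinfun_bound)
    show "0 \<le> 2 * real k / r"
      using r by simp
    fix v
    show "norm (blinfun_apply (T i) v) \<le> 2 * real k / r * norm v"
    proof (cases "v = 0")
      case False
      define u where "u = (r / norm v) *\<^sub>R v"
      have "norm u = r"
        using False r by (simp add: u_def)
      then have "w + u \<in> A k" "w \<in> A k"
        using r by (auto simp: subset_iff dist_norm)
      then have "norm (blinfun_apply (T i) (w + u)) \<le> k" "norm (blinfun_apply (T i) w) \<le> k"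
        unfolding A_def by auto
      then have "norm (blinfun_apply (T i) u) \<le> 2 * real k"
        using norm_triangle_ineq4[of "blinfun_apply (T i) (w + u)" "blinfun_apply (T i) w"]
        by (simp add: blinfun.add_right)
      then show ?thesis
        using False r by (simp add: u_def blinfun.scaleR_right field_simps)
    qed (simp add: blinfun.zero_right)
  qed
  then show ?thesis by blast
qed
section \<open>The Hahn-Banach theorem\<close>

text \<open>Homogeneity is required only as an inequality, since that is easier to verify; the equality for
  \<open>t \<ge> 0\<close> follows by applying it to \<open>inverse t\<close>.\<close>

definition sublinear :: "('a::real_vector \<Rightarrow> real) \<Rightarrow> bool"
  where "sublinear p \<longleftrightarrow> (\<forall>x y. p (x + y) \<le> p x + p y) \<and> (\<forall>t\<ge>0. \<forall>x. p (t *\<^sub>R x) \<le> t * p x)"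

lemma sublinear_add: "sublinear p \<Longrightarrow> p (x + y) \<le> p x + p y"
  unfolding sublinear_def by blast

lemma sublinear_scaleR_le: "sublinear p \<Longrightarrow> 0 \<le> t \<Longrightarrow> p (t *\<^sub>R x) \<le> t * p x"
  unfolding sublinear_def by blast

lemma sublinear_zero:
  assumes "sublinear p" shows "p 0 = 0"
  using sublinear_add[OF assms, of 0 0] sublinear_scaleR_le[OF assms, of 0 0] by simp

lemma sublinear_neg: 
  assumes "sublinear p" shows "- p (- x) \<le> p x"
  using sublinear_add[OF assms, of x "- x"] sublinear_zero[OF assms] by simp

lemma sublinear_scaleR:
  assumes p: "sublinear p" and t: "0 \<le> t"
  shows "p (t *\<^sub>R x) = t * p x"
proof (cases "t = 0")
  case False
  with t have "t > 0" by simp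
  then have "t * p x \<le> p (t *\<^sub>R x)"
    using sublinear_scaleR_le[OF p, of "inverse t" "t *\<^sub>R x"] by (simp add: field_simps)
  then show ?thesis
    using sublinear_scaleR_le[OF p t] by (simp add: antisym)
qed (simp add: sublinear_zero[OF p])

text \<open>The witness \<open>q z = (INF t\<ge>0. p (z + t y) - t p y)\<close> makes \<open>p\<close> smaller so that it becomes linear
  along \<open>y\<close>: together with \<open>- q y \<le> q (- y)\<close> and \<open>q y \<le> p y\<close> the last property forces
  \<open>q (- y) = - q y\<close>.\<close>

lemma sublinear_descent:
  assumes p: "sublinear p"
  obtains q where "sublinear q" "q \<le> p" "q (- y) \<le> - p y"
proof
  define B where "B z = (\<lambda>t. p (z + t *\<^sub>R y) - t * p y) ` {0..}" for z
  define q where "q z = Inf (B z)" for z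
  have bdd: "bdd_below (B z)" for z
  proof (rule bdd_belowI)
    fix b assume "b \<in> B z"
    then obtain t where t: "t \<ge> 0" "b = p (z + t *\<^sub>R y) - t * p y"
      by (auto simp: B_def)
    show "- p (- z) \<le> b"
      using sublinear_add[OF p, of "z + t *\<^sub>R y" "- z"] sublinear_scaleR[OF p t(1), of y] t(2)
      by simp
  qed
  have q_le: "q z \<le> p (z + t *\<^sub>R y) - t * p y" if "t \<ge> 0" for z t
    unfolding q_def using that by (intro cInf_lower bdd) (auto simp: B_def)
  have q_greatest: "c \<le> q z" if "\<And>t. t \<ge> 0 \<Longrightarrow> c \<le> p (z + t *\<^sub>R y) - t * p y" for c z
    unfolding q_def using that by (intro cInf_greatest) (auto simp: B_def)
  show "q \<le> p"
    using q_le[of 0] by (auto simp: le_fun_def)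
  show "q (- y) \<le> - p y"
    using q_le[of 1 "- y"] sublinear_zero[OF p] by simp
  show "sublinear q"
    unfolding sublinear_def
  proof (intro conjI allI impI)
    fix z w
    have "q (z + w) - q w \<le> p (z + s *\<^sub>R y) - s * p y" if s: "s \<ge> 0" for s
    proof -
      have "q (z + w) - (p (z + s *\<^sub>R y) - s * p y) \<le> q w"
      proof (rule q_greatest)
        fix t :: real assume t: "t \<ge> 0"
        have "q (z + w) \<le> p ((z + w) + (s + t) *\<^sub>R y) - (s + t) * p y"
          using s t by (intro q_le) simp
        also have "(z + w) + (s + t) *\<^sub>R y = (z + s *\<^sub>R y) + (w + t *\<^sub>R y)"
          by (simp add: algebra_simps)
        finally show "q (z + w) - (p (z + s *\<^sub>R y) - s * p y) \<le> p (w + t *\<^sub>R y) - t * p y"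
          using sublinear_add[OF p, of "z + s *\<^sub>R y" "w + t *\<^sub>R y"] by (simp add: algebra_simps)
      qed
      then show ?thesis by simp
    qed
    then show "q (z + w) \<le> q z + q w"
      using q_greatest[of "q (z + w) - q w" z] by simp
  next
    fix s :: real and z
    assume s: "0 \<le> s"
    show "q (s *\<^sub>R z) \<le> s * q z"
    proof (cases "s = 0")
      case True
      then show ?thesis
        using q_le[of 0 0] sublinear_zero[OF p] by simp
    next
      case False
      with s have "s > 0" by simp
      have "q (s *\<^sub>R z) / s \<le> q z"
      proof (rule q_greatest)
        fix t :: real assume "t \<ge> 0"
        then have "q (s *\<^sub>R z) \<le> p (s *\<^sub>R (z + t *\<^sub>R y)) - (s * t) * p y"
          using q_le[of "s * t" "s *\<^sub>R z"] s by (simp add: scaleR_add_right)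
        also have "\<dots> = s * (p (z + t *\<^sub>R y) - t * p y)"
          by (simp add: sublinear_scaleR[OF p s] right_diff_distrib)
        finally show "q (s *\<^sub>R z) / s \<le> p (z + t *\<^sub>R y) - t * p y"
          using \<open>s > 0\<close> by (simp add: field_simps)
      qed
      then show ?thesis
        using \<open>s > 0\<close> by (simp add: field_simps)
    qed
  qed
qed

text \<open>Zorn's lemma: the pointwise infimum of a chain of sublinear functionals below \<open>p\<close> is again
  sublinear, and it is finite because \<open>q z \<ge> - q (- z) \<ge> - p (- z)\<close> for every member \<open>q\<close>.\<close>

lemma minimal_sublinear_exists:
  assumes p: "sublinear p"
  obtains m where "sublinear m" "m \<le> p" "\<And>q. sublinear q \<Longrightarrow> q \<le> m \<Longrightarrow> q = m"
proof -
  define A where "A = {q. sublinear q \<and> q \<le> p}"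
  have "\<exists>m\<in>A. \<forall>q\<in>A. m \<ge> q \<longrightarrow> q = m"
  proof (rule predicate_Zorn)
    show "partial_order_on A (relation_of (\<ge>) A)"
      by (rule partial_order_on_relation_ofI) auto
    fix \<C> assume C: "\<C> \<in> Chains (relation_of (\<ge>) A)"
    then have CA: "\<C> \<subseteq> A" and chain: "\<And>q r. q \<in> \<C> \<Longrightarrow> r \<in> \<C> \<Longrightarrow> q \<le> r \<or> r \<le> q"
      unfolding Chains_def relation_of_def by auto
    show "\<exists>u\<in>A. \<forall>a\<in>\<C>. a \<ge> u"
    proof (cases "\<C> = {}")
      case True
      then show ?thesis using p by (auto simp: A_def)
    next
      case False
      define u where "u z = (INF q\<in>\<C>. q z)" for z
      have sub: "sublinear q" and le_p: "q \<le> p" if "q \<in> \<C>" for q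
        using that CA by (auto simp: A_def)
      have bdd: "bdd_below ((\<lambda>q. q z) ` \<C>)" for z
      proof (rule bdd_belowI2)
        fix q assume q: "q \<in> \<C>"
        show "- p (- z) \<le> q z"
          using sublinear_neg[OF sub[OF q], of z] le_funD[OF le_p[OF q], of "- z"] by simp
      qed
      have u_le: "u z \<le> q z" if "q \<in> \<C>" for q z
        unfolding u_def by (intro cINF_lower bdd that)
      have u_greatest: "c \<le> u z" if "\<And>q. q \<in> \<C> \<Longrightarrow> c \<le> q z" for c z
        unfolding u_def by (intro cINF_greatest False that)
      have "sublinear u"
        unfolding sublinear_def
      proof (intro conjI allI impI)
        fix z w
        have "u (z + w) - u w \<le> q z" if q: "q \<in> \<C>" for q
        proof -
          have "u (z + w) - q z \<le> u w"
          proof (rule u_greatest)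
            fix r assume r: "r \<in> \<C>"
            obtain s where s: "s \<in> \<C>" "s \<le> q" "s \<le> r"
              using chain[OF q r] q r by blast
            have "u (z + w) \<le> s z + s w"
              using u_le[OF s(1)] sublinear_add[OF sub[OF s(1)]] by (rule order_trans)
            then show "u (z + w) - q z \<le> r w"
              using le_funD[OF s(2), of z] le_funD[OF s(3), of w] by simp
          qed
          then show ?thesis by simp
        qed
        then show "u (z + w) \<le> u z + u w"
          using u_greatest[of "u (z + w) - u w" z] by simp
      next
        fix t :: real and z
        assume t: "0 \<le> t"
        show "u (t *\<^sub>R z) \<le> t * u z"
        proof (cases "t = 0")
          case True
          obtain q where q: "q \<in> \<C>" using \<open>\<C> \<noteq> {}\<close> by blast
          then show ?thesis
            using True u_le[OF q, of 0] sublinear_zero[OF sub[OF q]] by simp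
        next
          case False
          with t have "t > 0" by simp
          have "u (t *\<^sub>R z) / t \<le> u z"
          proof (rule u_greatest)
            fix q assume q: "q \<in> \<C>"
            show "u (t *\<^sub>R z) / t \<le> q z"
              using u_le[OF q, of "t *\<^sub>R z"] sublinear_scaleR[OF sub[OF q] t, of z] \<open>t > 0\<close>
              by (simp add: field_simps)
          qed
          then show ?thesis
            using \<open>t > 0\<close> by (simp add: field_simps)
        qed
      qed
      moreover have "u \<le> p"
      proof -
        obtain q where "q \<in> \<C>" using False by blast
        then show ?thesis
          using u_le le_p by (meson le_funI order_trans)
      qed
      ultimately show ?thesis
        using u_le by (auto simp: A_def le_fun_def)
    qed
  qed
  then show ?thesis
    using that unfolding A_def by (auto intro: order_trans)
qed

text \<open>A minimal sublinear functional cannot be decreased along any direction, so it is odd, and an odd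
  sublinear functional is linear.\<close>

lemma minimal_sublinear_linear:
  assumes m: "sublinear m" and min: "\<And>q. sublinear q \<Longrightarrow> q \<le> m \<Longrightarrow> q = m"
  shows "linear m"
proof -
  have neg: "m (- y) = - m y" for y
  proof -
    obtain q where "sublinear q" "q \<le> m" "q (- y) \<le> - m y"
      using sublinear_descent[OF m] by blast
    then have "m (- y) \<le> - m y"
      using min by metis
    then show ?thesis
      using sublinear_neg[OF m, of y] by simp
  qed
  show ?thesis
  proof (rule linearI)
    fix y z
    show "m (y + z) = m y + m z"
      using sublinear_add[OF m, of y z] sublinear_add[OF m, of "- y" "- z"]
        neg[of "y + z"] neg[of y] neg[of z] by simp
  next
    fix t :: real and y
    show "m (t *\<^sub>R y) = t *\<^sub>R m y"
    proof (cases "t \<ge> 0")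
      case False
      then have "m ((- t) *\<^sub>R (- y)) = (- t) * m (- y)"
        by (intro sublinear_scaleR[OF m]) simp
      then show ?thesis by (simp add: neg)
    qed (simp add: sublinear_scaleR[OF m])
  qed
qed

text \<open>Descending first along \<open>v\<close> pins the value at \<open>v\<close>: every linear functional below the result is
  at most \<open>- p v\<close> at \<open>- v\<close>.\<close>

theorem Hahn_Banach_sublinear:
  assumes p: "sublinear p"
  obtains u where "linear u" "u \<le> p" "u v = p v"
proof -
  obtain q where q: "sublinear q" "q \<le> p" "q (- v) \<le> - p v"
    using sublinear_descent[OF p] by blast
  obtain m where m: "sublinear m" "m \<le> q" "\<And>r. sublinear r \<Longrightarrow> r \<le> m \<Longrightarrow> r = m"
    using minimal_sublinear_exists[OF q(1)] by blast
  have lin: "linear m"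
    using minimal_sublinear_linear[OF m(1,3)] by blast
  moreover have "m \<le> p"
    using m(2) q(2) by (rule order_trans)
  moreover have "m v = p v"
    using linear_neg[OF lin, of v] le_funD[OF m(2), of "- v"] q(3) le_funD[OF \<open>m \<le> p\<close>, of v]
    by simp
  ultimately show ?thesis
    using that by blast
qed

corollary real_norming_functional:
  fixes v :: "'a::real_normed_vector"
  obtains u where "linear u" "\<And>z. u z \<le> norm z" "u v = norm v"
proof -
  have "sublinear (norm :: 'a \<Rightarrow> real)"
    unfolding sublinear_def by (simp add: norm_triangle_ineq)
  then show ?thesis
    using Hahn_Banach_sublinear[of norm v] that by (auto simp: le_fun_def)
qed

text \<open>The map \<open>\<phi> (a + b \<i>) = a + b j\<close> is a ring homomorphism from \<open>\<complex>\<close> that increases norms by at most a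
  fixed factor. Applied to powers, this bound improves to \<open>norm (\<phi> z) \<le> 1\<close> on the unit circle, and
  applied to \<open>z\<close> and its inverse it yields equality. Multiplicativity of
  the norm is what makes this work.\<close>

lemma norm_of_real_add_imaginary:
  fixes j :: "'k::real_normed_field"
  assumes j: "j * j = - 1"
  shows "norm (of_real a + of_real b * j) = sqrt (a\<^sup>2 + b\<^sup>2)"
proof -
  define \<phi> where "\<phi> z = of_real (Re z) + of_real (Im z) * j" for z
  have mult: "\<phi> (z * w) = \<phi> z * \<phi> w" for z w
  proof -
    have "\<phi> z * \<phi> w = of_real (Re z * Re w) + of_real (Im z * Im w) * (j * j)
        + of_real (Re z * Im w + Im z * Re w) * j"
      by (simp add: \<phi>_def algebra_simps)
    then show ?thesis
      unfolding j by (simp add: \<phi>_def algebra_simps)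
  qed
  have one: "\<phi> 1 = 1"
    by (simp add: \<phi>_def)
  have power: "\<phi> (z ^ n) = \<phi> z ^ n" for z n
    by (induction n) (simp_all add: one mult)
  have "norm j ^ 2 = 1"
    using j by (metis norm_minus_cancel norm_mult norm_one power2_eq_square)
  then have "norm j = 1 \<or> norm j = - 1"
    by (simp add: power2_eq_1_iff)
  then have norm_j: "norm j = 1"
    using norm_ge_zero[of j] by linarith
  have crude: "norm (\<phi> z) \<le> 2 * cmod z" for z
  proof -
    have "norm (\<phi> z) \<le> \<bar>Re z\<bar> + \<bar>Im z\<bar>"
      unfolding \<phi>_def by (rule norm_triangle_le) (simp add: norm_mult norm_j)
    then show ?thesis
      using abs_Re_le_cmod[of z] abs_Im_le_cmod[of z] by simp
  qed
  have le1: "norm (\<phi> z) \<le> 1" if z: "cmod z = 1" for z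
  proof (rule ccontr)
    assume "\<not> ?thesis"
    then obtain n where "2 < norm (\<phi> z) ^ n"
      using real_arch_pow[of "norm (\<phi> z)" 2] by auto
    then show False
      using crude[of "z ^ n"] by (simp add: power norm_power z)
  qed
  have unit: "norm (\<phi> z) = 1" if z: "cmod z = 1" for z
  proof -
    have "1 = norm (\<phi> z) * norm (\<phi> (inverse z))"
    proof -
      have "z * inverse z = 1"
        using z by (intro right_inverse) auto
      then show ?thesis
        by (metis mult one norm_mult norm_one)
    qed
    moreover have "norm (\<phi> (inverse z)) \<le> 1"
      by (rule le1) (simp add: norm_inverse z)
    ultimately show ?thesis
      using le1[OF z] mult_left_le[of "norm (\<phi> (inverse z))" "norm (\<phi> z)"] by simp
  qed
  have "norm (\<phi> z) = cmod z" for z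
  proof (cases "z = 0")
    case False
    have "z = of_real (cmod z) * sgn z"
      using False by (simp add: sgn_div_norm scaleR_conv_of_real)
    then have "\<phi> z = \<phi> (of_real (cmod z)) * \<phi> (sgn z)"
      by (metis mult)
    moreover have "norm (\<phi> (sgn z)) = 1"
      using False by (intro unit) (simp add: norm_sgn)
    moreover have "norm (\<phi> (of_real (cmod z))) = cmod z"
      by (simp add: \<phi>_def)
    ultimately show ?thesis
      by (simp add: norm_mult)
  qed (simp add: \<phi>_def)
  from this[of "Complex a b"] show ?thesis
    by (simp add: \<phi>_def cmod_def)
qed

text \<open>A real norming functional \<open>u\<close> is turned into one over \<open>\<complex>\<close> by \<open>g z = u z - j u (j z)\<close>. Its norm is
  still at most one: rotate \<open>z\<close> by a scalar of modulus one until \<open>g z\<close> is a nonnegative real; then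
  \<open>g z = u z \<le> \<parallel>z\<parallel>\<close>.\<close>

theorem norming_functional:
  fixes smul :: "'k::real_or_complex_field \<Rightarrow> 'a::banach \<Rightarrow> 'a"
  assumes "banach_space_over smul"
  obtains g :: "'a \<Rightarrow>\<^sub>L 'k"
  where "g \<in> dual_space smul" "norm g \<le> 1" "norm v \<le> norm (blinfun_apply g v)"
proof -
  interpret banach_space_over smul by fact
  obtain u :: "'a \<Rightarrow> real" where u: "linear u" "\<And>z. u z \<le> norm z" "u v = norm v"
    using real_norming_functional by blast
  interpret u: linear u by fact
  have abs_u: "\<bar>u z\<bar> \<le> norm z" for z
    using u(2)[of z] u(2)[of "- z"] by (simp add: u.neg)
  have smul_scaleR: "smul (of_real r) w = r *\<^sub>R w" "smul (r *\<^sub>R c) w = r *\<^sub>R smul c w"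
      "smul c (r *\<^sub>R w) = r *\<^sub>R smul c w" for r c w
    by (simp_all add: scale_of_real scaleR_conv_of_real flip: scale_scale)
       (metis scale_of_real scale_left_commute)
  consider (real) "\<forall>z::'k. \<exists>a. z = a *\<^sub>R 1"
    | (complex) j :: 'k where "j * j = - 1" "\<forall>z. \<exists>a b. z = a *\<^sub>R 1 + b *\<^sub>R j"
    using real_or_complex by blast
  then show ?thesis
  proof cases
    case real
    define g where "g z = (of_real (u z) :: 'k)" for z
    have bl: "bounded_linear g"
      by (rule bounded_linear_intro[where K = 1])
         (simp_all add: g_def u.add u.scale abs_u scaleR_conv_of_real)
    have hom: "g (smul c z) = c * g z" for c z
    proof -
      obtain a where "c = of_real a"
        using real unfolding scaleR_conv_of_real by (metis mult.right_neutral)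
      then show ?thesis
        by (simp add: g_def smul_scaleR u.scale)
    qed
    show ?thesis
    proof
      show "Blinfun g \<in> dual_space smul"
        using hom by (simp add: dual_space_def bounded_linear_Blinfun_apply[OF bl])
      show "norm (Blinfun g) \<le> 1"
        by (rule norm_blinfun_bound)
           (simp_all add: bounded_linear_Blinfun_apply[OF bl] g_def abs_u)
      show "norm v \<le> norm (blinfun_apply (Blinfun g) v)"
        by (simp add: bounded_linear_Blinfun_apply[OF bl] g_def u)
    qed
  next
    case complex
    note j = complex(1)
    note norm_j = norm_of_real_add_imaginary[OF j]
    have jj: "smul j (smul j z) = - z" for z
      using scale_scale[of j j z] by (simp add: j)
    define g where "g z = of_real (u z) + of_real (- u (smul j z)) * j" for z
    have add: "g (y + z) = g y + g z" for y z
      by (simp add: g_def u.add scale_right_distrib algebra_simps)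
    have sc: "g (r *\<^sub>R z) = of_real r * g z" for r z
      by (simp add: g_def u.scale smul_scaleR algebra_simps)
    have gj: "g (smul j z) = j * g z" for z
    proof -
      have "j * g z = of_real (u z) * j + of_real (- u (smul j z)) * (j * j)"
        by (simp add: g_def algebra_simps)
      then show ?thesis
        unfolding j by (simp add: g_def jj u.neg del: scale_scale)
    qed
    have hom: "g (smul c z) = c * g z" for c z
    proof -
      obtain a b where c: "c = a *\<^sub>R 1 + b *\<^sub>R j"
        using complex(2) by blast
      have "smul c z = a *\<^sub>R z + b *\<^sub>R smul j z"
        by (simp only: c scale_left_distrib smul_scaleR(2) scale_one)
      then show ?thesis
        by (simp add: c add sc gj distrib_right scaleR_conv_of_real)
    qed
    have u_le: "\<bar>u z\<bar> \<le> norm (g z)" for z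
      unfolding g_def norm_j by (rule real_le_rsqrt) simp
    have le: "norm (g z) \<le> norm z" for z
    proof (cases "g z = 0")
      case False
      define c where "c = of_real (norm (g z)) / g z"
      have norm_c: "norm c = 1"
        using False by (simp add: c_def norm_divide)
      have gc: "g (smul c z) = of_real (norm (g z))"
        using False by (simp add: hom c_def)
      have "norm (of_real (u (smul c z) - norm (g z)) + of_real (- u (smul j (smul c z))) * j) = 0"
        using gc by (simp add: g_def algebra_simps)
      then have "u (smul c z) = norm (g z)"
        unfolding norm_j by (simp add: sum_power2_eq_zero_iff)
      then show ?thesis
        using u(2)[of "smul c z"] by (simp add: norm_scale norm_c)
    qed simp
    have bl: "bounded_linear g"
      by (rule bounded_linear_intro[where K = 1])
         (simp_all add: add sc le scaleR_conv_of_real)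
    show ?thesis
    proof
      show "Blinfun g \<in> dual_space smul"
        using hom by (simp add: dual_space_def bounded_linear_Blinfun_apply[OF bl])
      show "norm (Blinfun g) \<le> 1"
        by (rule norm_blinfun_bound)
           (simp_all add: bounded_linear_Blinfun_apply[OF bl] le)
      show "norm v \<le> norm (blinfun_apply (Blinfun g) v)"
        using u_le[of v] by (simp add: bounded_linear_Blinfun_apply[OF bl] u)
    qed
  qed
qed
section \<open>Bases and their biorthogonal functionals\<close>

text \<open>For uniformly bounded operators, convergence to the identity passes to norm limits of vectors.
  This is applied to the adjoints of the basis projections, which in general converge to the
  identity only on part of the dual.\<close>

lemma closed_Collect_tendsto_self:
  fixes L :: "nat \<Rightarrow> 'a::real_normed_vector \<Rightarrow> 'a"
  assumes lin: "\<And>n. linear (L n)" and bound: "\<And>n z. norm (L n z) \<le> K * norm z"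
  shows "closed {z. (\<lambda>n. L n z) \<longlonglongrightarrow> z}"
proof -
  have "(\<lambda>n. L n z) \<longlonglongrightarrow> z" if z: "z \<in> closure {z. (\<lambda>n. L n z) \<longlonglongrightarrow> z}" for z
  proof (rule LIMSEQ_I)
    fix e :: real assume e: "0 < e"
    define M where "M = \<bar>K\<bar> + 1"
    have M: "M > 0" "K \<le> M" unfolding M_def by auto
    obtain w where w: "(\<lambda>n. L n w) \<longlonglongrightarrow> w" "dist w z < e / (2 * (M + 1))"
      using z e M unfolding closure_approachable 
      by (metis divide_pos_pos add_pos_pos mem_Collect_eq mult_pos_pos zero_less_numeral
          zero_less_one)
    obtain N where N: "\<And>n. n \<ge> N \<Longrightarrow> norm (L n w - w) < e / 2"
      using LIMSEQ_D[OF w(1), of "e / 2"] e by auto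
    have "norm (L n z - z) < e" if n: "n \<ge> N" for n
    proof -
      have "L n z - z = L n (z - w) + (L n w - w) + (w - z)"
        by (simp add: linear_diff[OF lin])
      then have "norm (L n z - z) \<le> norm (L n (z - w)) + norm (L n w - w) + norm (w - z)"
        by (metis add.commute norm_triangle_mono norm_triangle_ineq order_refl)
      moreover have "norm (L n (z - w)) \<le> M * norm (w - z)"
        using bound[of n "z - w"] M(2) by (metis mult_right_mono norm_ge_zero norm_minus_commute order_trans)
      moreover have "(M + 1) * norm (w - z) < e / 2"
        using w(2) M by (simp add: dist_norm field_simps)
      ultimately show ?thesis
        using N[OF n] by (simp add: algebra_simps)
    qed
    then show "\<exists>N. \<forall>n\<ge>N. norm (L n z - z) < e" by blast
  qed
  then show ?thesis
    unfolding closure_subset_eq[symmetric] by blast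
qed

lemma module_dual_scale:
  "module (dual_scale :: 'k::real_normed_field \<Rightarrow> ('a::real_normed_vector \<Rightarrow>\<^sub>L 'k) \<Rightarrow> _)"
  by (rule module.intro; rule blinfun_eqI)
    (simp_all add: dual_scale_apply blinfun.add_left distrib_left distrib_right mult.assoc)

lemma bounded_linear_dual_scale: "bounded_linear (dual_scale c)"
  unfolding dual_scale_def
  by (rule bounded_bilinear.bounded_linear_right[OF bounded_bilinear_blinfun_compose])

lemma closed_dual_space: "closed (dual_space smul)"
  unfolding dual_space_def
  by (intro closed_Collect_all closed_Collect_eq continuous_intros)

lemma subspace_dual_space:
  "module.subspace dual_scale (dual_space smul)"
  unfolding module.subspace_def[OF module_dual_scale]
  by (auto simp: dual_space_def dual_scale_apply blinfun.add_left algebra_simps)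

lemma RUC_constant_nonneg:
  assumes "RUC s C y" and "s 1 (y 0) \<noteq> 0"
  shows "0 \<le> C"
proof -
  have "0 \<le> C * norm (\<Sum>i<1. s 1 (y i))"
    using assms(1) sign_mean_nonneg[of 1 "\<lambda>i. s 1 (y i)"] unfolding RUC_def
    by (meson order_trans)
  then show ?thesis
    using assms(2) by (simp add: zero_le_mult_iff)
qed

locale biorthogonal_basis = banach_space_over smul
  for smul :: "'k::real_or_complex_field \<Rightarrow> 'a::banach \<Rightarrow> 'a" +
  fixes x :: "nat \<Rightarrow> 'a" and f :: "nat \<Rightarrow> ('a \<Rightarrow>\<^sub>L 'k)"
  assumes basis: "schauder_basis_of smul x UNIV"
    and dual: "range f \<subseteq> dual_space smul"
    and biorth: "biorthogonal f x"
begin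

lemma f_x: "blinfun_apply (f m) (x n) = (if m = n then 1 else 0)"
  using biorth by (simp add: biorthogonal_def)

lemma f_smul: "blinfun_apply (f m) (smul c v) = c * blinfun_apply (f m) v"
  using dual by (auto simp: dual_space_def)

text \<open>Continuity of \<open>f j\<close> allows it to be applied term by term. Hence the coefficient functionals of the
  basis are the given \<open>f i\<close>, and they are known to be continuous.\<close>

lemma coefficients_unique:
  assumes "(\<lambda>i. smul (a i) (x i)) sums v"
  shows "a = (\<lambda>i. blinfun_apply (f i) v)"
proof
  fix j
  have "(\<lambda>i. blinfun_apply (f j) (smul (a i) (x i))) sums blinfun_apply (f j) v"
    by (rule bounded_linear.sums[OF blinfun.bounded_linear_right assms])
  moreover have "(\<lambda>i. blinfun_apply (f j) (smul (a i) (x i))) = (\<lambda>i. if i = j then a i else 0)"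
    by (auto simp: f_smul f_x)
  then have "(\<lambda>i. blinfun_apply (f j) (smul (a i) (x i))) sums a j"
    using sums_single[of j a] by simp
  ultimately show "a j = blinfun_apply (f j) v"
    by (rule sums_unique2[symmetric])
qed

lemma expansion: "(\<lambda>i. smul (blinfun_apply (f i) v) (x i)) sums v"
  using basis coefficients_unique unfolding schauder_basis_of_def by blast

lemma basis_proj_eq: "basis_proj smul x n v = (\<Sum>i<n. smul (blinfun_apply (f i) v) (x i))"
proof -
  have "basis_coeff smul x v = (\<lambda>i. blinfun_apply (f i) v)"
    unfolding basis_coeff_def using expansion coefficients_unique by (rule the_equality)
  then show ?thesis
    by (simp add: basis_proj_def)
qed

lemma bounded_linear_basis_proj: "bounded_linear (basis_proj smul x n)"
proof -
  have "bounded_linear (\<lambda>v. smul (blinfun_apply (f i) v) (x i))" for i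
  proof (rule bounded_linear_intro[where K = "norm (f i) * norm (x i)"])
    show "smul (blinfun_apply (f i) (r *\<^sub>R v)) (x i) = r *\<^sub>R smul (blinfun_apply (f i) v) (x i)" for r v
      by (metis blinfun.scaleR_right scaleR_conv_of_real scale_of_real scale_scale)
    show "norm (smul (blinfun_apply (f i) v) (x i)) \<le> norm v * (norm (f i) * norm (x i))" for v
      using mult_right_mono[OF norm_blinfun[of "f i" v] norm_ge_zero[of "x i"]]
      by (simp add: norm_scale ac_simps)
  qed (simp add: blinfun.add_right scale_left_distrib)
  then have "bounded_linear (\<lambda>v. \<Sum>i<n. smul (blinfun_apply (f i) v) (x i))"
    by (rule bounded_linear_sum)
  then show ?thesis
    by (simp add: basis_proj_eq[abs_def])
qed

lemma basis_proj_tendsto: "(\<lambda>n. basis_proj smul x n v) \<longlonglongrightarrow> v"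
  using expansion[of v] by (simp add: sums_def basis_proj_eq)

lemma onorm_basis_proj_bounded: "\<exists>K. \<forall>n. onorm (basis_proj smul x n) \<le> K"
proof -
  define T where "T n = Blinfun (basis_proj smul x n)" for n
  have T: "blinfun_apply (T n) = basis_proj smul x n" for n
    by (simp add: T_def bounded_linear_Blinfun_apply[OF bounded_linear_basis_proj])
  have "bdd_above (range (\<lambda>n. norm (blinfun_apply (T n) v)))" for v
    using convergent_imp_Bseq[OF convergentI[OF basis_proj_tendsto[of v]]]
    by (auto simp: T Bseq_def intro: bdd_aboveI2)
  then show ?thesis
    using uniform_boundedness[of T] by (simp add: norm_blinfun.rep_eq T)
qed

text \<open>Without an upper bound for the norms of the projections, the supremum defining the basic constant
  would be an arbitrary number.\<close>

lemma onorm_basis_proj_le_basic_constant: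
  assumes "n \<ge> 1"
  shows "onorm (basis_proj smul x n) \<le> basic_constant smul x"
proof -
  have "bdd_above ((\<lambda>n. onorm (basis_proj smul x n)) ` {1..})"
    using onorm_basis_proj_bounded by (auto simp: bdd_above_def)
  then show ?thesis
    unfolding basic_constant_def using assms by (intro cSUP_upper) auto
qed

text \<open>The partial sums of the formal expansion of \<open>g\<close> in the \<open>f i\<close> are \<open>g \<circ> P\<^sub>n\<close>. All bounds on them come
  from bounds on \<open>P\<^sub>n\<close>.\<close>

lemma adjoint_basis_proj:
  assumes "g \<in> dual_space smul"
  shows "blinfun_apply (\<Sum>i<n. dual_scale (blinfun_apply g (x i)) (f i)) v
    = blinfun_apply g (basis_proj smul x n v)"
  using assms by (simp add: basis_proj_eq blinfun.sum_left blinfun.sum_right dual_scale_apply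
      dual_space_def mult.commute)

lemma norm_adjoint_basis_proj_le:
  assumes "g \<in> dual_space smul"
  shows "norm (\<Sum>i<n. dual_scale (blinfun_apply g (x i)) (f i))
    \<le> norm g * onorm (basis_proj smul x n)"
proof (rule norm_blinfun_bound)
  show "0 \<le> norm g * onorm (basis_proj smul x n)"
    by (simp add: onorm_pos_le[OF bounded_linear_basis_proj])
  fix v
  have "norm (blinfun_apply g (basis_proj smul x n v)) \<le> norm g * norm (basis_proj smul x n v)"
    by (rule norm_blinfun)
  also have "\<dots> \<le> norm g * (onorm (basis_proj smul x n) * norm v)"
    by (intro mult_left_mono onorm bounded_linear_basis_proj) simp
  finally show "norm (blinfun_apply (\<Sum>i<n. dual_scale (blinfun_apply g (x i)) (f i)) v)
      \<le> norm g * onorm (basis_proj smul x n) * norm v"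
    by (simp add: adjoint_basis_proj[OF assms] mult.assoc)
qed

text \<open>The functionals \<open>g\<close> with \<open>g \<circ> P\<^sub>n \<longlonglongrightarrow> g\<close> form a subspace, closed because the \<open>P\<^sub>n\<close> are uniformly
  bounded, which contains every \<open>f k\<close>, for \<open>f k \<circ> P\<^sub>n = f k\<close> as soon as \<open>n > k\<close>.\<close>

lemma dual_expansion:
  assumes "g \<in> closure (module.span dual_scale (range f))"
  shows "(\<lambda>i. dual_scale (blinfun_apply g (x i)) (f i)) sums g"
proof -
  interpret D: module "dual_scale :: 'k \<Rightarrow> ('a \<Rightarrow>\<^sub>L 'k) \<Rightarrow> _"
    by (rule module_dual_scale)
  define Pb where "Pb n = Blinfun (basis_proj smul x n)" for n
  have Pb: "blinfun_apply (Pb n) = basis_proj smul x n" for n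
    by (simp add: Pb_def bounded_linear_Blinfun_apply[OF bounded_linear_basis_proj])
  define S where "S = dual_space smul \<inter> {g :: 'a \<Rightarrow>\<^sub>L 'k. (\<lambda>n. g o\<^sub>L Pb n) \<longlonglongrightarrow> g}"
  have partial: "(\<Sum>i<n. dual_scale (blinfun_apply g (x i)) (f i)) = g o\<^sub>L Pb n"
    if "g \<in> dual_space smul" for n g
    using that by (intro blinfun_eqI) (simp add: adjoint_basis_proj Pb)
  have f_S: "f k \<in> S" for k
  proof -
    have fk: "f k \<in> dual_space smul"
      using dual by auto
    have "\<forall>n\<ge>Suc k. f k = f k o\<^sub>L Pb n"
      by (auto intro!: blinfun_eqI simp: adjoint_basis_proj[OF fk] Pb basis_proj_eq
          blinfun.sum_right f_smul f_x if_distrib cong: if_cong)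
    then have "(\<lambda>n. f k o\<^sub>L Pb n) \<longlonglongrightarrow> f k"
      by (metis (mono_tags, lifting) eventually_sequentially tendsto_eventually)
    then show ?thesis
      using fk by (simp add: S_def)
  qed
  have "D.subspace {g :: 'a \<Rightarrow>\<^sub>L 'k. (\<lambda>n. g o\<^sub>L Pb n) \<longlonglongrightarrow> g}"
  proof (rule D.subspaceI)
    show "0 \<in> {g :: 'a \<Rightarrow>\<^sub>L 'k. (\<lambda>n. g o\<^sub>L Pb n) \<longlonglongrightarrow> g}"
      by (simp add: bounded_bilinear.zero_left[OF bounded_bilinear_blinfun_compose])
  next
    fix g h :: "'a \<Rightarrow>\<^sub>L 'k"
    assume "g \<in> {g. (\<lambda>n. g o\<^sub>L Pb n) \<longlonglongrightarrow> g}" "h \<in> {g. (\<lambda>n. g o\<^sub>L Pb n) \<longlonglongrightarrow> g}"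
    then show "g + h \<in> {g. (\<lambda>n. g o\<^sub>L Pb n) \<longlonglongrightarrow> g}"
      by (simp add: bounded_bilinear.add_left[OF bounded_bilinear_blinfun_compose] tendsto_add)
  next
    fix c :: 'k and g :: "'a \<Rightarrow>\<^sub>L 'k"
    assume g: "g \<in> {g. (\<lambda>n. g o\<^sub>L Pb n) \<longlonglongrightarrow> g}"
    have "dual_scale c g o\<^sub>L Pb n = dual_scale c (g o\<^sub>L Pb n)" for n
      by (rule blinfun_eqI) (simp add: dual_scale_apply)
    then show "dual_scale c g \<in> {g. (\<lambda>n. g o\<^sub>L Pb n) \<longlonglongrightarrow> g}"
      using g bounded_linear.tendsto[OF bounded_linear_dual_scale] by simp
  qed
  then have "D.subspace S"
    unfolding S_def using subspace_dual_space by (rule D.subspace_inter[rotated])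
  then have span: "D.span (range f) \<subseteq> S"
    using f_S by (intro D.span_minimal) auto
  obtain K where K: "\<And>n. norm (Pb n) \<le> K"
    using onorm_basis_proj_bounded by (auto simp: norm_blinfun.rep_eq Pb)
  have "closed {g :: 'a \<Rightarrow>\<^sub>L 'k. (\<lambda>n. g o\<^sub>L Pb n) \<longlonglongrightarrow> g}"
  proof (rule closed_Collect_tendsto_self[where K = K])
    show "linear (\<lambda>g :: 'a \<Rightarrow>\<^sub>L 'k. g o\<^sub>L Pb n)" for n
      by (rule bounded_linear.linear[OF bounded_bilinear.bounded_linear_left[OF
            bounded_bilinear_blinfun_compose]])
    show "norm (g o\<^sub>L Pb n) \<le> K * norm g" for n and g :: "'a \<Rightarrow>\<^sub>L 'k"
      using norm_blinfun_compose[of g "Pb n"] mult_left_mono[OF K[of n] norm_ge_zero[of g]]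
      by (simp add: mult.commute)
  qed
  then have "closed S"
    unfolding S_def by (intro closed_Int closed_dual_space)
  then have "g \<in> S"
    using closure_minimal[OF span] assms by blast
  then show ?thesis
    by (simp add: S_def sums_def partial)
qed

lemma basic_sequence_dual: "basic_sequence dual_scale f"
proof -
  interpret D: module "dual_scale :: 'k \<Rightarrow> ('a \<Rightarrow>\<^sub>L 'k) \<Rightarrow> _"
    by (rule module_dual_scale)
  have unique: "a = (\<lambda>j. blinfun_apply g (x j))" if "(\<lambda>i. dual_scale (a i) (f i)) sums g" for a g
  proof
    fix j
    have "(\<lambda>i. blinfun_apply (dual_scale (a i) (f i)) (x j)) sums blinfun_apply g (x j)"
      by (rule bounded_linear.sums[OF blinfun.bounded_linear_left that])
    moreover have "(\<lambda>i. blinfun_apply (dual_scale (a i) (f i)) (x j)) sums a j"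
      using sums_single[of j a] by (simp add: dual_scale_apply f_x if_distrib cong: if_cong)
    ultimately show "a j = blinfun_apply g (x j)"
      by (rule sums_unique2[symmetric])
  qed
  have "range f \<subseteq> closure (D.span (range f))"
    using D.span_superset closure_subset by (rule order_trans)
  moreover have "\<exists>!a. (\<lambda>i. dual_scale (a i) (f i)) sums g"
    if "g \<in> closure (D.span (range f))" for g
    using dual_expansion[OF that] unique by (rule ex1I)
  ultimately show ?thesis
    unfolding basic_sequence_def schauder_basis_of_def by blast
qed

lemma basic_sequence_basis: "basic_sequence smul x"
proof -
  have "range x \<subseteq> closure (span (range x))"
    using span_superset closure_subset by (rule order_trans)
  then show ?thesis
    using basis unfolding basic_sequence_def schauder_basis_of_def by blast
qed

section \<open>Duality of RUC and RUD\<close>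

text \<open>For each \<open>N \<ge> n\<close> the functional \<open>\<Sum>\<^sub>i\<^sub><\<^sub>n a\<^sub>i f\<^sub>i\<close> is paired with the first \<open>N\<close> terms of the expansion of
  \<open>v\<close>. Stopping at \<open>N = n\<close> would cost the norm of \<open>P\<^sub>n\<close>; letting \<open>N\<close> grow replaces
  \<open>\<parallel>P\<^sub>N v\<parallel>\<close> by \<open>\<parallel>v\<parallel>\<close>.\<close>

lemma RUC_basis_imp_dual_estimate:
  assumes "RUC smul C x"
  shows "norm (\<Sum>i<n. dual_scale (a i) (f i)) \<le> C * sign_mean n (\<lambda>i. dual_scale (a i) (f i))"
proof (rule norm_blinfun_bound)
  let ?F = "sign_mean n (\<lambda>i. dual_scale (a i) (f i))"
  have "x 0 \<noteq> 0"
    using f_x[of 0 0] by (auto simp: blinfun.zero_right)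
  then have C: "0 \<le> C"
    using RUC_constant_nonneg[OF assms] by simp
  then show "0 \<le> C * ?F"
    by (simp add: sign_mean_nonneg)
  fix v
  \<comment> \<open>Padding with zeros lets both sign means run over the same \<open>N\<close> signs.\<close>
  define \<phi> where "\<phi> i = dual_scale (if i < n then a i else 0) (f i)" for i
  have bound: "norm (blinfun_apply (\<Sum>i<n. dual_scale (a i) (f i)) v)
      \<le> ?F * (C * norm (basis_proj smul x N v))" if N: "n \<le> N" for N
  proof -
    define y where "y i = smul (blinfun_apply (f i) v) (x i)" for i
    have "blinfun_apply (\<Sum>i<n. dual_scale (a i) (f i)) v = (\<Sum>i<n. blinfun_apply (\<phi> i) (y i))"
      by (simp add: blinfun.sum_left \<phi>_def y_def dual_scale_apply f_smul f_x)
    also have "\<dots> = (\<Sum>i<N. blinfun_apply (\<phi> i) (y i))"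
      using N by (intro sum.mono_neutral_left) (auto simp: \<phi>_def dual_scale_apply)
    also have "norm \<dots> \<le> sign_mean N \<phi> * sign_mean N y"
      by (rule norm_pairing_le_sign_mean_mult)
         (simp add: \<phi>_def y_def dual_scale_apply f_smul f_x)
    also have "sign_mean N \<phi> = sign_mean n \<phi>"
      using N by (rule sign_mean_extend_zero)
         (auto intro!: blinfun_eqI simp: \<phi>_def dual_scale_apply)
    also have "sign_mean n \<phi> = ?F"
      by (rule sign_mean_cong) (simp add: \<phi>_def)
    also have "sign_mean N y \<le> C * norm (basis_proj smul x N v)"
      using assms[unfolded RUC_def, THEN conjunct2, rule_format,
          where n = N and a = "\<lambda>i. blinfun_apply (f i) v"]
      by (simp add: y_def[abs_def] basis_proj_eq)
    finally show ?thesis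
      by (simp add: mult_left_mono sign_mean_nonneg)
  qed
  have "(\<lambda>N. ?F * (C * norm (basis_proj smul x N v))) \<longlonglongrightarrow> ?F * (C * norm v)"
    by (intro tendsto_intros basis_proj_tendsto)
  then have "norm (blinfun_apply (\<Sum>i<n. dual_scale (a i) (f i)) v) \<le> ?F * (C * norm v)"
    using bound by (intro LIMSEQ_le_const) auto
  then show "norm (blinfun_apply (\<Sum>i<n. dual_scale (a i) (f i)) v) \<le> C * ?F * norm v"
    by (simp add: mult_ac)
qed

text \<open>The vector \<open>v = \<Sum>\<^sub>i\<^sub><\<^sub>n a\<^sub>i x\<^sub>i\<close> is tested against \<open>g \<circ> P\<^sub>n = \<Sum>\<^sub>i\<^sub><\<^sub>n g(x\<^sub>i) f\<^sub>i\<close> with \<open>g\<close> norming \<open>v\<close>. Passing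
  from \<open>g\<close> to \<open>g \<circ> P\<^sub>n\<close>, a combination of the \<open>f\<^sub>i\<close> to which the RUC bound applies, costs the
  basic constant.\<close>

lemma RUC_dual_imp_basis_estimate:
  assumes "RUC dual_scale C f"
  shows "norm (\<Sum>i<n. smul (a i) (x i))
    \<le> C * basic_constant smul x * sign_mean n (\<lambda>i. smul (a i) (x i))"
proof (cases "n = 0")
  case False
  define v where "v = (\<Sum>i<n. smul (a i) (x i))"
  define y where "y i = smul (a i) (x i)" for i
  obtain g where g: "g \<in> dual_space smul" "norm g \<le> 1" "norm v \<le> norm (blinfun_apply g v)"
    using norming_functional[OF banach_space_over_axioms] by blast
  define \<phi> where "\<phi> i = dual_scale (blinfun_apply g (x i)) (f i)" for i
  have "f 0 \<noteq> 0"
    using f_x[of 0 0] by auto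
  then have C: "0 \<le> C"
    using RUC_constant_nonneg[OF assms] by (simp add: module.scale_one[OF module_dual_scale])
  have "blinfun_apply g v = (\<Sum>i<n. blinfun_apply (\<phi> i) (y i))"
    using g(1) by (simp add: v_def y_def \<phi>_def blinfun.sum_right dual_scale_apply f_smul f_x
        dual_space_def mult.commute)
  then have "norm v \<le> norm (\<Sum>i<n. blinfun_apply (\<phi> i) (y i))"
    using g(3) by simp
  also have "\<dots> \<le> sign_mean n \<phi> * sign_mean n y"
    by (rule norm_pairing_le_sign_mean_mult)
       (simp add: \<phi>_def y_def dual_scale_apply f_smul f_x)
  also have "\<dots> \<le> C * basic_constant smul x * sign_mean n y"
  proof (intro mult_right_mono sign_mean_nonneg)
    have "sign_mean n \<phi> \<le> C * norm (\<Sum>i<n. \<phi> i)"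
      using assms[unfolded RUC_def, THEN conjunct2, rule_format,
          where n = n and a = "\<lambda>i. blinfun_apply g (x i)"]
      by (simp add: \<phi>_def[abs_def])
    also have "norm (\<Sum>i<n. \<phi> i) \<le> norm g * onorm (basis_proj smul x n)"
      unfolding \<phi>_def by (rule norm_adjoint_basis_proj_le[OF g(1)])
    also have "\<dots> \<le> 1 * basic_constant smul x"
      using g(2) False onorm_pos_le[OF bounded_linear_basis_proj]
      by (intro mult_mono onorm_basis_proj_le_basic_constant) auto
    finally show "sign_mean n \<phi> \<le> C * basic_constant smul x"
      using C by (simp add: mult_left_mono)
  qed
  finally show ?thesis
    by (simp add: v_def y_def[abs_def])
qed simp

end

theorem proposition2p11:
  fixes smul :: "'k::real_or_complex_field \<Rightarrow> 'a::banach \<Rightarrow> 'a"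
    and x :: "nat \<Rightarrow> 'a"
    and C :: real
  assumes "banach_space_over smul"
    and "schauder_basis_of smul x UNIV"
  shows "(RUC smul C x \<longrightarrow>
           (\<forall>f :: nat \<Rightarrow> ('a \<Rightarrow>\<^sub>L 'k). range f \<subseteq> dual_space smul \<and> biorthogonal f x \<longrightarrow>
              RUD dual_scale (2 * C) f)) \<and>
         (\<forall>f :: nat \<Rightarrow> ('a \<Rightarrow>\<^sub>L 'k). range f \<subseteq> dual_space smul \<and> biorthogonal f x \<and>
              RUC dual_scale C f \<longrightarrow>
            RUD smul (C * basic_constant smul x) x)"
proof (intro conjI impI allI)
  fix f :: "nat \<Rightarrow> ('a \<Rightarrow>\<^sub>L 'k)"
  assume ruc: "RUC smul C x" and f: "range f \<subseteq> dual_space smul \<and> biorthogonal f x"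
  interpret biorthogonal_basis smul x f
    using assms f by (simp add: biorthogonal_basis_def biorthogonal_basis_axioms_def)
  have double: "r \<le> 2 * C * t" if "0 \<le> r" "r \<le> C * t" for r t :: real
    using that by simp
  have "norm (\<Sum>i<n. dual_scale (a i) (f i))
      \<le> 2 * C * sign_mean n (\<lambda>i. dual_scale (a i) (f i))" for n a
    by (rule double[OF norm_ge_zero RUC_basis_imp_dual_estimate[OF ruc]])
  then show "RUD dual_scale (2 * C) f"
    using basic_sequence_dual by (simp add: RUD_def)
next
  fix f :: "nat \<Rightarrow> ('a \<Rightarrow>\<^sub>L 'k)"
  assume f: "range f \<subseteq> dual_space smul \<and> biorthogonal f x \<and> RUC dual_scale C f"
  interpret biorthogonal_basis smul x f
    using assms f by (simp add: biorthogonal_basis_def biorthogonal_basis_axioms_def)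
  show "RUD smul (C * basic_constant smul x) x"
    using basic_sequence_basis RUC_dual_imp_basis_estimate f by (simp add: RUD_def)
qed
end
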